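(* Suppose that $\mathcal{Q}(\cdot)J(\cdot)$ is normal and that $\sup_{q\in\mathbb{R}^n}\{\lambda_{\max}(M(q,\Theta))\}<\infty$ holds for all constant, physically consistent inertial parameters $\Theta=(\Phi_1^\top,\ldots,\Phi_N^\top)^\top\in\mathbb{R}^{10N}$ (i.e. whenever $f(\Phi_l)\succ0$ for all $l\in\{1,\ldots,N\}$). If the (time-dependent) inertial parameters $\Phi_1,\ldots,\Phi_N:[0,\infty)\to\mathbb{R}^{10}$ are upper bounded and uniformly physically consistent, then the mass matrix is uniformly bounded with $\alpha_1\mathrm{I}_n\preceq M(q,\Theta(t))\preceq\alpha_2\mathrm{I}_n$ for all $q\in\mathbb{R}^n$, $t\ge0$, where $0<\alpha_1\le\alpha_2<\infty$ are constants.
   Context: Notation: $\mathrm{I}_p$ is the $p\times p$ identity, $\mathrm{sym}(p)$ the real symmetric $p\times p$ matrices, $\lambda_{\min},\lambda_{\max}$ the extremal eigenvalues of a symmetric matrix. For $x\in\mathbb{R}^3$, $\mathcal{S}(x)$ is the skew-symmetric $3\times3$ matrix with $\mathcal{S}(x)y=x\times y$ for all $y\in\mathbb{R}^3$. Kinematics: an open kinematic chain of $N$ bodies with generalized coordinates $q\in\mathbb{R}^n$. Kinematic parameters are constant (standing assumption), so the forward kinematic map $F:\mathbb{R}^n\to\mathbb{R}^{6N}$ depends only on $q$; write $F(q)=(F_{z_1}(q)^\top,F_{\phi_1}(q)^\top,\ldots,F_{z_N}(q)^\top,F_{\phi_N}(q)^\top)^\top$ with $F_{z_l},F_{\phi_l}\in\mathbb{R}^3$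 (position of the origin and rotation angles of the $l$th body-fixed frame), and $J(q)=\partial F(q)/\partial q\in\mathbb{R}^{6N\times n}$. Rotation angles $\phi\in\mathbb{R}^3$ parameterize rotation matrices $\mathcal{R}(\phi)\in\mathrm{SO}(3)$, and $E(\phi)\in\mathbb{R}^{3\times3}$ is the matrix such that along any differentiable curve $\phi(t)$ one has $\mathcal{R}(\phi)^\top\dot{\mathcal{R}}(\phi)=\mathcal{S}(E(\phi)\dot\phi)$. Set $Q(\phi)=\mathrm{diag}(\mathcal{R}(\phi)^\top,E(\phi))\in\mathbb{R}^{6\times6}$ and $\mathcal{Q}(q)=\mathrm{diag}(Q(F_{\phi_1}(q)),\ldots,Q(F_{\phi_N}(q)))\in\mathbb{R}^{6N\times6N}$. Inertial parameters: $\Phi_l\in\mathbb{R}^{10}$ has entries, in order, $m_l,h_{1,l},h_{2,l},h_{3,l},I_{11,l},I_{22,l},I_{33,l},I_{12,l},I_{23,l},I_{13,l}$; $h_l=(h_{1,l},h_{2,l},h_{3,l})^\top$, and $I_l\in\mathrm{sym}(3)$ is the symmetric matrix with entries $I_{ij,l}$. $\Theta=(\Phi_1^\top,\ldots,\Phi_N^\top)^\top\in\mathbb{R}^{10N}$. Define $$f(\Phi_l)=\begin{pmatrix}\frac12\mathrm{tr}(I_l)\mathrm{I}_3-I_l&h_l\\ h_l^\top&m_l\end{pmatrix}\in\mathrm{sym}(4),\qquad Z(\Phi_l)=\begin{pmatrix}m_l\mathrm{I}_3&-\mathcal{S}(h_l)\\ -\mathcal{S}(h_l)^\top&I_l\end{pmatrix}\in\mathrm{sym}(6),$$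 $\mathcal{Z}(\Theta)=\mathrm{diag}(Z(\Phi_1),\ldots,Z(\Phi_N))$, and the mass matrix $$M(q,\Theta)=J(q)^\top\mathcal{Q}(q)^\top\mathcal{Z}(\Theta)\mathcal{Q}(q)J(q)\in\mathrm{sym}(n).$$ Inertial parameters may depend on time $t\ge0$. Definitions: $\mathcal{Q}(\cdot)J(\cdot)$ is called normal if $\inf_{q\in\mathbb{R}^n}\{\lambda_{\min}(J(q)^\top\mathcal{Q}(q)^\top\mathcal{Q}(q)J(q))\}>0$. Constant inertial parameters are physically consistent if $f(\Phi_l)\succ0$ for all $l$. Time-dependent inertial parameters are uniformly physically consistent if $\inf_{t\ge0}\{\lambda_{\min}(f(\Phi_l(t)))\}>0$ for all $l\in\{1,\ldots,N\}$, and upper bounded if $\sup_{t\ge0}\{\lambda_{\max}(f(\Phi_l(t)))\}<\infty$ for all $l\in\{1,\ldots,N\}$. *)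

theory Defs
  imports "HOL-Analysis.Analysis"
begin

definition eigenvalues :: "real^'n^'n \<Rightarrow> real set" where
  "eigenvalues A = {k. \<exists>v. v \<noteq> 0 \<and> A *v v = k *\<^sub>R v}"

text \<open>The following two are meaningful for symmetric matrices, which have finitely many
  eigenvalues and at least one. Elsewhere they are only applied to such matrices.\<close>

definition lambda_min :: "real^'n^'n \<Rightarrow> real" where
  "lambda_min A = Min (eigenvalues A)"

definition lambda_max :: "real^'n^'n \<Rightarrow> real" where
  "lambda_max A = Max (eigenvalues A)"

definition symmetric_matrix :: "real^'n^'n \<Rightarrow> bool" where
  "symmetric_matrix A \<longleftrightarrow> transpose A = A"

definition pos_def :: "real^'n^'n \<Rightarrow> bool" where
  "pos_def A \<longleftrightarrow> symmetric_matrix A \<and> (\<forall>v. v \<noteq> 0 \<longrightarrow> v \<bullet> (A *v v) > 0)"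

definition pos_semidef :: "real^'n^'n \<Rightarrow> bool" where
  "pos_semidef A \<longleftrightarrow> symmetric_matrix A \<and> (\<forall>v. v \<bullet> (A *v v) \<ge> 0)"

definition loewner_le :: "real^'n^'n \<Rightarrow> real^'n^'n \<Rightarrow> bool" (infix "\<preceq>\<^sub>L" 50) where
  "A \<preceq>\<^sub>L B \<longleftrightarrow> symmetric_matrix A \<and> symmetric_matrix B \<and> pos_semidef (B - A)"

text \<open>Block matrices are indexed by sum types (two by two blocks) and by product types
  (block diagonal matrices with blocks of equal size). With one block per body,
  the \<open>6N\<close>-dimensional space has the index type \<open>'b \<times> (3 + 3)\<close>, where \<open>'b\<close> is the type of the
  \<open>N\<close> bodies; the first summand of \<open>3 + 3\<close> is the position and the second one the rotation
  angles.\<close>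

definition block_matrix ::
    "real^'c^'a \<Rightarrow> real^'d^'a \<Rightarrow> real^'c^'b \<Rightarrow> real^'d^'b \<Rightarrow> real^('c + 'd)^('a + 'b)" where
  "block_matrix A B C D = (\<chi> i j. case i of
      Inl i' \<Rightarrow> (case j of Inl j' \<Rightarrow> A $ i' $ j' | Inr j' \<Rightarrow> B $ i' $ j')
    | Inr i' \<Rightarrow> (case j of Inl j' \<Rightarrow> C $ i' $ j' | Inr j' \<Rightarrow> D $ i' $ j'))"

definition block_diag :: "('b::finite \<Rightarrow> real^'a^'a) \<Rightarrow> real^('b \<times> 'a)^('b \<times> 'a)" where
  "block_diag B = (\<chi> i j. if fst i = fst j then B (fst i) $ snd i $ snd j else 0)"

definition skew :: "real^3 \<Rightarrow> real^3^3" where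
  "skew x = matrix (cross3 x)"

lemma skew_mult: "skew x *v y = cross3 x y"
proof -
  have "linear (cross3 x)"
    by (rule linearI) (simp_all add: cross_add_right cross_mult_right)
  then show ?thesis
    by (simp add: skew_def matrix_works)
qed

text \<open>The entries of \<open>\<Phi> :: real^10\<close> are, in order,
  \<open>m, h1, h2, h3, I11, I22, I33, I12, I23, I13\<close>.\<close>

definition mass :: "real^10 \<Rightarrow> real" where
  "mass \<Phi> = \<Phi> $ 1"

definition first_moment :: "real^10 \<Rightarrow> real^3" where
  "first_moment \<Phi> = vector [\<Phi> $ 2, \<Phi> $ 3, \<Phi> $ 4]"

definition inertia :: "real^10 \<Rightarrow> real^3^3" where
  "inertia \<Phi> = vector [vector [\<Phi> $ 5, \<Phi> $ 8, \<Phi> $ 10],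
                      vector [\<Phi> $ 8, \<Phi> $ 6, \<Phi> $ 9],
                      vector [\<Phi> $ 10, \<Phi> $ 9, \<Phi> $ 7]]"

definition pseudo_inertia :: "real^10 \<Rightarrow> real^(3 + 1)^(3 + 1)" where
  "pseudo_inertia \<Phi> = block_matrix
     (mat (trace (inertia \<Phi>) / 2) - inertia \<Phi>) (columnvector (first_moment \<Phi>))
     (rowvector (first_moment \<Phi>))               (mat (mass \<Phi>))"

definition spatial_inertia :: "real^10 \<Rightarrow> real^(3 + 3)^(3 + 3)" where
  "spatial_inertia \<Phi> = block_matrix
     (mat (mass \<Phi>))                         (- skew (first_moment \<Phi>))
     (- transpose (skew (first_moment \<Phi>)))  (inertia \<Phi>)"

definition chain_inertia :: "real^10^'b::finite \<Rightarrow> real^('b \<times> (3 + 3))^('b \<times> (3 + 3))" where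
  "chain_inertia \<Theta> = block_diag (\<lambda>l. spatial_inertia (\<Theta> $ l))"

definition physically_consistent :: "real^10^'b \<Rightarrow> bool" where
  "physically_consistent \<Theta> \<longleftrightarrow> (\<forall>l. pos_def (pseudo_inertia (\<Theta> $ l)))"

text \<open>Infima and suprema are taken in the extended reals, so that they are infinite for
  unbounded sets. Parameters at negative times are irrelevant.\<close>

definition uniformly_physically_consistent :: "(real \<Rightarrow> real^10^'b) \<Rightarrow> bool" where
  "uniformly_physically_consistent \<Theta> \<longleftrightarrow>
     (\<forall>l. (INF t\<in>{0..}. ereal (lambda_min (pseudo_inertia (\<Theta> t $ l)))) > 0)"

definition inertial_upper_bounded :: "(real \<Rightarrow> real^10^'b) \<Rightarrow> bool" where
  "inertial_upper_bounded \<Theta> \<longleftrightarrow>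
     (\<forall>l. (SUP t\<in>{0..}. ereal (lambda_max (pseudo_inertia (\<Theta> t $ l)))) < \<infinity>)"

definition angular_rate_matrix :: "(real^3 \<Rightarrow> real^3^3) \<Rightarrow> (real^3 \<Rightarrow> real^3^3) \<Rightarrow> bool" where
  "angular_rate_matrix R E \<longleftrightarrow>
     (\<forall>\<phi> \<phi>'. (\<forall>t. (\<phi> has_vector_derivative \<phi>' t) (at t)) \<longrightarrow>
        (\<forall>t. \<exists>R'. ((\<lambda>s. R (\<phi> s)) has_vector_derivative R') (at t) \<and>
                  transpose (R (\<phi> t)) ** R' = skew (E (\<phi> t) *v \<phi>' t)))"

definition rotation_angles :: "(real^'n \<Rightarrow> real^('b::finite \<times> (3 + 3))) \<Rightarrow> 'b \<Rightarrow> real^'n \<Rightarrow> real^3" where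
  "rotation_angles F l q = (\<chi> i. F q $ (l, Inr i))"

definition kin_jacobian ::
    "(real^'n \<Rightarrow> real^('b::finite \<times> (3 + 3))) \<Rightarrow> real^'n \<Rightarrow> real^'n^('b \<times> (3 + 3))" where
  "kin_jacobian F q = jacobian F (at q)"

definition body_Q ::
    "(real^3 \<Rightarrow> real^3^3) \<Rightarrow> (real^3 \<Rightarrow> real^3^3) \<Rightarrow> real^3 \<Rightarrow> real^(3 + 3)^(3 + 3)" where
  "body_Q R E \<phi> = block_matrix (transpose (R \<phi>)) 0 0 (E \<phi>)"

definition chain_Q ::
    "(real^'n \<Rightarrow> real^('b::finite \<times> (3 + 3))) \<Rightarrow> (real^3 \<Rightarrow> real^3^3) \<Rightarrow> (real^3 \<Rightarrow> real^3^3) \<Rightarrow>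
     real^'n \<Rightarrow> real^('b \<times> (3 + 3))^('b \<times> (3 + 3))" where
  "chain_Q F R E q = block_diag (\<lambda>l. body_Q R E (rotation_angles F l q))"

definition mass_matrix ::
    "(real^'n \<Rightarrow> real^('b::finite \<times> (3 + 3))) \<Rightarrow> (real^3 \<Rightarrow> real^3^3) \<Rightarrow> (real^3 \<Rightarrow> real^3^3) \<Rightarrow>
     real^'n \<Rightarrow> real^10^'b \<Rightarrow> real^'n^'n" where
  "mass_matrix F R E q \<Theta> =
     transpose (kin_jacobian F q) ** transpose (chain_Q F R E q) ** chain_inertia \<Theta> **
     chain_Q F R E q ** kin_jacobian F q"

definition normal_QJ ::
    "(real^'n \<Rightarrow> real^('b::finite \<times> (3 + 3))) \<Rightarrow> (real^3 \<Rightarrow> real^3^3) \<Rightarrow> (real^3 \<Rightarrow> real^3^3) \<Rightarrow> bool" where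
  "normal_QJ F R E \<longleftrightarrow>
     (INF q. ereal (lambda_min
        (transpose (kin_jacobian F q) ** transpose (chain_Q F R E q) **
         chain_Q F R E q ** kin_jacobian F q))) > 0"

end

theory Submission
  imports Defs
begin

text \<open>The quadratic form of the mass matrix is a sum of values of the quadratic forms of the
  pseudo-inertia matrices \<open>f(\<Phi>\<^sub>l)\<close>, at vectors that do not depend on the inertial parameters:
  this is the kinetic energy written with the second moments of the mass distribution.
  It is therefore monotone in them. Bounds \<open>\<lambda>\<^sub>1 I \<preceq> f(\<Phi>\<^sub>l(t)) \<preceq> \<lambda>\<^sub>2 I\<close> give the same bounds for
  \<open>M(q, \<Theta>(t))\<close> in terms of \<open>M(q, \<Theta>\<^sub>1)\<close>, where every body of the constant \<open>\<Theta>\<^sub>1\<close> has the identity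
  as pseudo-inertia matrix. The matrix \<open>M(q, \<Theta>\<^sub>1)\<close> is bounded above by hypothesis, and
  below by normality, because the spatial inertia of each body of \<open>\<Theta>\<^sub>1\<close> is \<open>diag(I, 2I) \<succeq> I\<close>.\<close>

section \<open>Symmetric matrices: quadratic forms and extremal eigenvalues\<close>

lemma inner_vector_matrix_mult: "x \<bullet> (y v* A) = y \<bullet> (A *v x)" for A :: "real^'n^'m"
  using dot_lmul_matrix[of y A x] by (simp add: inner_commute)

lemma inner_matrix_commute:
  fixes A :: "real^'n^'n"
  assumes "symmetric_matrix A"
  shows "x \<bullet> (A *v y) = y \<bullet> (A *v x)"
proof -
  have "A *v y = y v* A"
    using assms transpose_matrix_vector[of A y] by (simp add: symmetric_matrix_def)
  then show ?thesis
    by (simp add: inner_vector_matrix_mult)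
qed

text \<open>If \<open>w = B *v u\<close> were nonzero, a small step from \<open>u\<close> in the
  direction \<open>-w\<close> would make the form negative to first order.\<close>

lemma pos_semidef_null_vector:
  fixes B :: "real^'n^'n"
  assumes "pos_semidef B" and "u \<bullet> (B *v u) = 0"
  shows "B *v u = 0"
proof -
  define w where "w = B *v u"
  have sym: "symmetric_matrix B" and nonneg: "v \<bullet> (B *v v) \<ge> 0" for v
    using assms(1) by (auto simp: pos_semidef_def)
  have quad: "0 \<le> 2 * s * (w \<bullet> w) + s\<^sup>2 * (w \<bullet> (B *v w))" for s
  proof -
    have "u \<bullet> (B *v w) = w \<bullet> w"
      using inner_matrix_commute[OF sym, of u w] by (simp add: w_def)
    then have "(u + s *\<^sub>R w) \<bullet> (B *v (u + s *\<^sub>R w)) = 2 * s * (w \<bullet> w) + s\<^sup>2 * (w \<bullet> (B *v w))"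
      using assms(2) by (simp add: w_def[symmetric] matrix_vector_right_distrib matrix_vector_mult_scaleR
          inner_add_left inner_add_right power2_eq_square algebra_simps)
    then show ?thesis
      using nonneg[of "u + s *\<^sub>R w"] by simp
  qed
  define c where "c = w \<bullet> (B *v w)"
  have c: "c \<ge> 0" using nonneg by (simp add: c_def)
  \<comment> \<open>The denominator \<open>c + 1\<close> is positive even if \<open>c = 0\<close>.
    For this \<open>s\<close> the right-hand side of \<open>quad\<close> collapses to
    \<open>-(c + 2)\<close> times the square of \<open>s\<close>, which forces \<open>s = 0\<close>
    and hence \<open>w = 0\<close>.\<close>
  define s where "s = - (w \<bullet> w) / (c + 1)"
  have ww: "w \<bullet> w = - s * (c + 1)"
    using c by (simp add: s_def)
  have "2 * s * (w \<bullet> w) + s\<^sup>2 * c = - ((c + 2) * s\<^sup>2)"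
    unfolding ww by (simp add: algebra_simps power2_eq_square)
  then have "(c + 2) * s\<^sup>2 \<le> 0"
    using quad[of s, folded c_def] by linarith
  then have "s = 0"
    using c by (simp add: mult_le_0_iff)
  then show ?thesis
    using c by (simp add: s_def w_def)
qed

text \<open>Eigenvectors for distinct eigenvalues are orthogonal, and a pairwise orthogonal set is
  finite. Finiteness gives \<open>Min\<close> and \<open>Max\<close> in \<open>lambda_min\<close>
  and \<open>lambda_max\<close> their intended meaning.\<close>

lemma finite_eigenvalues:
  fixes A :: "real^'n^'n"
  assumes "symmetric_matrix A"
  shows "finite (eigenvalues A)"
proof -
  have "\<forall>k\<in>eigenvalues A. \<exists>v. v \<noteq> 0 \<and> A *v v = k *\<^sub>R v"
    by (simp add: eigenvalues_def)
  then obtain v where v: "\<And>k. k \<in> eigenvalues A \<Longrightarrow> v k \<noteq> 0 \<and> A *v v k = k *\<^sub>R v k"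
    by metis
  have orth: "v k \<bullet> v l = 0" if "k \<in> eigenvalues A" "l \<in> eigenvalues A" "k \<noteq> l" for k l
    using inner_matrix_commute[OF assms, of "v k" "v l"] v[OF that(1)] v[OF that(2)] that(3)
    by (simp add: inner_commute)
  \<comment> \<open>A common value of \<open>v\<close> at two distinct eigenvalues would be
    orthogonal to itself, hence zero.\<close>
  have "inj_on v (eigenvalues A)"
    by (metis inj_onI inner_eq_zero_iff orth v)
  moreover have "finite (v ` eigenvalues A)"
    by (rule pairwise_orthogonal_imp_finite) (auto simp: pairwise_def orthogonal_def intro!: orth)
  ultimately show ?thesis
    using finite_imageD by blast
qed

text \<open>Take for \<open>k\<close> the maximum of the form on the unit sphere, attained at some
  \<open>u\<close>. Then \<open>k I - A\<close> is positive semidefinite and its form vanishes at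
  \<open>u\<close>, so \<open>u\<close> is an eigenvector for \<open>k\<close>.\<close>

lemma eigenvalue_bounds_quadratic_form:
  fixes A :: "real^'n^'n"
  assumes A: "symmetric_matrix A"
  obtains k where "k \<in> eigenvalues A" and "\<And>v. v \<bullet> (A *v v) \<le> k * (v \<bullet> v)"
proof -
  have "continuous_on (sphere 0 1) (\<lambda>v. v \<bullet> (A *v v))"
    by (intro continuous_intros linear_continuous_on_compose matrix_vector_mul_linear)
  then obtain u :: "real^'n" where u: "norm u = 1"
    and max: "\<And>v. norm v = 1 \<Longrightarrow> v \<bullet> (A *v v) \<le> u \<bullet> (A *v u)"
    using continuous_attains_sup[of "sphere (0 :: real^'n) 1" "\<lambda>v. v \<bullet> (A *v v)"] by auto
  define k where "k = u \<bullet> (A *v u)"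
  have bound: "v \<bullet> (A *v v) \<le> k * (v \<bullet> v)" for v
  proof (cases "v = 0")
    case False
    then have "(v /\<^sub>R norm v) \<bullet> (A *v (v /\<^sub>R norm v)) \<le> k"
      unfolding k_def by (intro max) simp
    with False show ?thesis
      by (simp add: matrix_vector_mult_scaleR dot_square_norm field_simps power2_eq_square)
  qed simp
  have diff: "(k *\<^sub>R mat 1 - A) *v v = k *\<^sub>R v - A *v v" for v
    by (simp add: matrix_vector_mult_diff_rdistrib scaleR_matrix_vector_assoc[symmetric])
  have "pos_semidef (k *\<^sub>R mat 1 - A)"
    using A bound unfolding pos_semidef_def symmetric_matrix_def diff
    by (auto simp: inner_diff_right transpose_def mat_def vec_eq_iff)
  moreover have "u \<bullet> ((k *\<^sub>R mat 1 - A) *v u) = 0"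
    unfolding diff using u by (simp add: inner_diff_right dot_square_norm k_def)
  ultimately have "A *v u = k *\<^sub>R u"
    using pos_semidef_null_vector diff by fastforce
  then have "k \<in> eigenvalues A"
    using u by (auto simp: eigenvalues_def intro!: exI[of _ u])
  then show ?thesis
    using that bound by blast
qed

lemma quadratic_form_le_lambda_max:
  fixes A :: "real^'n^'n"
  assumes "symmetric_matrix A"
  shows "v \<bullet> (A *v v) \<le> lambda_max A * (v \<bullet> v)"
proof -
  obtain k where k: "k \<in> eigenvalues A" "v \<bullet> (A *v v) \<le> k * (v \<bullet> v)"
    using eigenvalue_bounds_quadratic_form[OF assms] by metis
  have "k \<le> lambda_max A"
    using k finite_eigenvalues[OF assms] by (simp add: lambda_max_def)
  then show ?thesis
    by (meson k(2) inner_ge_zero mult_right_mono order_trans)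
qed

lemma matrix_vector_uminus: "(- A) *v v = - (A *v v)" for A :: "real^'n^'m"
  by (simp add: matrix_vector_mult_def vec_eq_iff sum_negf)

lemma lambda_min_le_quadratic_form:
  fixes A :: "real^'n^'n"
  assumes "symmetric_matrix A"
  shows "lambda_min A * (v \<bullet> v) \<le> v \<bullet> (A *v v)"
proof -
  \<comment> \<open>The lower bound comes from the upper bound for \<open>-A\<close>, whose
    eigenvalues are the negatives of those of \<open>A\<close>.\<close>
  have "symmetric_matrix (- A)"
    using assms by (simp add: symmetric_matrix_def transpose_def vec_eq_iff)
  then obtain k where k: "k \<in> eigenvalues (- A)" "v \<bullet> ((- A) *v v) \<le> k * (v \<bullet> v)"
    using eigenvalue_bounds_quadratic_form by metis
  then have "- k \<in> eigenvalues A"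
    by (auto simp: eigenvalues_def matrix_vector_uminus) (metis minus_equation_iff)
  then have "lambda_min A \<le> - k"
    using finite_eigenvalues[OF assms] by (simp add: lambda_min_def)
  then have "lambda_min A * (v \<bullet> v) \<le> - k * (v \<bullet> v)"
    by (intro mult_right_mono) simp_all
  with k(2) show ?thesis
    by (simp add: matrix_vector_uminus)
qed

section \<open>Congruences and block matrices\<close>

lemma symmetric_congruence:
  fixes A :: "real^'n^'n" and B :: "real^'m^'n"
  assumes "symmetric_matrix A"
  shows "symmetric_matrix (transpose B ** A ** B)"
  using assms by (simp add: symmetric_matrix_def matrix_transpose_mul matrix_mul_assoc)

lemma inner_congruence:
  fixes A :: "real^'n^'n" and B :: "real^'m^'n"
  shows "v \<bullet> ((transpose B ** A ** B) *v v) = (B *v v) \<bullet> (A *v (B *v v))"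
  by (simp add: matrix_vector_mul_assoc[symmetric] inner_vector_matrix_mult inner_commute)

lemma symmetric_block_matrix:
  assumes "symmetric_matrix A" and "C = transpose B" and "symmetric_matrix D"
  shows "symmetric_matrix (block_matrix A B C D)"
  using assms
  by (auto simp: symmetric_matrix_def block_matrix_def transpose_def vec_eq_iff split: sum.split)

lemma symmetric_block_diag:
  assumes "\<And>l. symmetric_matrix (B l)"
  shows "symmetric_matrix (block_diag B)"
  using assms by (auto simp: symmetric_matrix_def block_diag_def transpose_def vec_eq_iff)

lemma symmetric_inertia: "symmetric_matrix (inertia \<Phi>)"
  by (simp add: symmetric_matrix_def inertia_def transpose_def vec_eq_iff forall_3)

lemma symmetric_mat: "symmetric_matrix (mat c)"
  by (auto simp: symmetric_matrix_def transpose_mat)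

lemma symmetric_pseudo_inertia: "symmetric_matrix (pseudo_inertia \<Phi>)"
  unfolding pseudo_inertia_def
  using symmetric_inertia[of \<Phi>]
  by (intro symmetric_block_matrix symmetric_mat)
     (auto simp: symmetric_matrix_def transpose_def vec_eq_iff mat_def rowvector_def columnvector_def)

lemma symmetric_chain_inertia: "symmetric_matrix (chain_inertia \<Theta>)"
  unfolding chain_inertia_def spatial_inertia_def
  by (intro symmetric_block_diag symmetric_block_matrix symmetric_mat symmetric_inertia)
     (simp add: transpose_def vec_eq_iff)

lemma sum_UNIV_Plus: "(\<Sum>i\<in>UNIV. f i) = (\<Sum>i\<in>UNIV. f (Inl i)) + (\<Sum>i\<in>UNIV. f (Inr i))"
  for f :: "'a::finite + 'b::finite \<Rightarrow> 'c::comm_monoid_add"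
  unfolding UNIV_Plus_UNIV[symmetric] by (subst sum.Plus) simp_all

lemma sum_UNIV_prod: "(\<Sum>i\<in>UNIV. f i) = (\<Sum>l\<in>UNIV. \<Sum>i\<in>UNIV. f (l, i))"
  for f :: "'a::finite \<times> 'b::finite \<Rightarrow> 'c::comm_monoid_add"
  unfolding UNIV_Times_UNIV[symmetric] by (simp add: sum.cartesian_product)

definition block :: "real^('b::finite \<times> 'a) \<Rightarrow> 'b \<Rightarrow> real^'a" where
  "block v l = (\<chi> i. v $ (l, i))"

lemma inner_block_diag:
  fixes B :: "'b::finite \<Rightarrow> real^'a^'a"
  shows "v \<bullet> (block_diag B *v v) = (\<Sum>l\<in>UNIV. block v l \<bullet> (B l *v block v l))"
proof -
  have "(\<Sum>l'\<in>UNIV. \<Sum>j\<in>UNIV. (if l = l' then B l $ i $ j else 0) * v $ (l', j))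
      = (\<Sum>j\<in>UNIV. B l $ i $ j * v $ (l, j))" for l i
  proof -
    have "(\<Sum>l'\<in>UNIV. \<Sum>j\<in>UNIV. (if l = l' then B l $ i $ j else 0) * v $ (l', j))
        = (\<Sum>l'\<in>UNIV. if l = l' then \<Sum>j\<in>UNIV. B l $ i $ j * v $ (l', j) else 0)"
      by (intro sum.cong) auto
    then show ?thesis by simp
  qed
  then show ?thesis
    by (simp add: inner_vec_def block_diag_def block_def matrix_vector_mult_def sum_UNIV_prod
        cong: if_cong)
qed

lemma inner_block_matrix:
  fixes v :: "real^('a::finite + 'b::finite)"
  defines "a \<equiv> (\<chi> i. v $ Inl i)" and "b \<equiv> (\<chi> i. v $ Inr i)"
  shows "v \<bullet> (block_matrix A B C D *v v) =
    a \<bullet> (A *v a) + a \<bullet> (B *v b) + b \<bullet> (C *v a) + b \<bullet> (D *v b)"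
  by (simp add: inner_vec_def block_matrix_def matrix_vector_mult_def sum_UNIV_Plus a_def b_def
      distrib_left sum.distrib)

lemma scaled_identity_mult: "(c *\<^sub>R mat 1) *v v = c *\<^sub>R v" for v :: "real^'n"
  by (simp add: scaleR_matrix_vector_assoc[symmetric])

lemma mat_mult: "mat c *v v = c *\<^sub>R v" for v :: "real^'n"
proof -
  have "mat c = (c *\<^sub>R mat 1 :: real^'n^'n)"
    by (simp add: mat_def vec_eq_iff)
  then show ?thesis
    by (simp add: scaled_identity_mult)
qed

section \<open>Kinetic energy in terms of the pseudo-inertia matrix\<close>

lemma spatial_inertia_inner:
  fixes v :: "real^(3 + 3)"
  defines "a \<equiv> (\<chi> i. v $ Inl i)" and "b \<equiv> (\<chi> i. v $ Inr i)"
  shows "v \<bullet> (spatial_inertia \<Phi> *v v) =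
    mass \<Phi> * (a \<bullet> a) - 2 * (a \<bullet> cross3 (first_moment \<Phi>) b) + b \<bullet> (inertia \<Phi> *v b)"
  unfolding spatial_inertia_def inner_block_matrix a_def[symmetric] b_def[symmetric]
  by (simp add: matrix_vector_uminus mat_mult inner_vector_matrix_mult skew_mult)

lemma pseudo_inertia_inner:
  fixes w :: "real^(3 + 1)"
  defines "x \<equiv> (\<chi> i. w $ Inl i)" and "r \<equiv> w $ Inr 1"
  shows "w \<bullet> (pseudo_inertia \<Phi> *v w) = trace (inertia \<Phi>) / 2 * (x \<bullet> x) - x \<bullet> (inertia \<Phi> *v x)
    + 2 * r * (first_moment \<Phi> \<bullet> x) + mass \<Phi> * r\<^sup>2"
  unfolding pseudo_inertia_def inner_block_matrix x_def[symmetric]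
  by (simp add: matrix_vector_mult_diff_rdistrib inner_diff_right mat_mult,
      simp add: inner_vec_def matrix_vector_mult_def rowvector_def columnvector_def r_def sum_3
        power2_eq_square algebra_simps)

text \<open>The matrix \<open>trace I / 2 - I\<close> holds the second moments of the mass
  distribution, and the form of \<open>I\<close> at \<open>b\<close> is the second moment of
  \<open>b \<times> x\<close>. The \<open>k\<close>th component of \<open>b \<times> x\<close> is
  \<open>(axis k 1 \<times> b) \<bullet> x\<close>, which gives the summands.\<close>

lemma inertia_quadratic_form:
  fixes b :: "real^3"
  shows "b \<bullet> (inertia \<Phi> *v b) =
    (\<Sum>k\<in>UNIV. trace (inertia \<Phi>) / 2 * (cross3 (axis k 1) b \<bullet> cross3 (axis k 1) b) -
      cross3 (axis k 1) b \<bullet> (inertia \<Phi> *v cross3 (axis k 1) b))"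
proof -
  \<comment> \<open>Writing the form as an explicit polynomial turns the claim into a polynomial
    identity in the entries of \<open>b\<close> and \<open>\<Phi>\<close>.\<close>
  define Q where "Q x y z = \<Phi> $ 5 * x\<^sup>2 + \<Phi> $ 6 * y\<^sup>2 + \<Phi> $ 7 * z\<^sup>2 +
    2 * (\<Phi> $ 8 * (x * y) + \<Phi> $ 9 * (y * z) + \<Phi> $ 10 * (x * z))" for x y z
  have Q: "x \<bullet> (inertia \<Phi> *v x) = Q (x $ 1) (x $ 2) (x $ 3)" for x
    unfolding inertia_def inner_vec_def matrix_vector_mult_def sum_3 Q_def power2_eq_square
    by (simp add: algebra_simps)
  have tr: "trace (inertia \<Phi>) = \<Phi> $ 5 + \<Phi> $ 6 + \<Phi> $ 7"
    by (simp add: trace_def inertia_def sum_3)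
  show ?thesis
    unfolding Q tr
    by (simp add: sum_3 cross3_def axis_def inner_vec_def Q_def power2_eq_square,
        simp add: algebra_simps add_divide_distrib)
qed

text \<open>A body moving with linear velocity \<open>a\<close> and angular velocity \<open>b\<close> gives the mass at \<open>x\<close>
  the velocity \<open>a + b \<times> x\<close>. Its \<open>k\<close>th component is the inner product of the vector below
  with \<open>(x, 1)\<close>.\<close>

definition velocity_functional :: "3 \<Rightarrow> real^(3 + 3) \<Rightarrow> real^(3 + 1)" where
  "velocity_functional k v = (\<chi> i. case i of
      Inl j \<Rightarrow> cross3 (axis k 1) (\<chi> j. v $ Inr j) $ j
    | Inr _ \<Rightarrow> v $ Inl k)"

text \<open>Both sides are twice the kinetic energy, the right one split by the components of
  \<open>a + b \<times> x\<close>. The mixed terms agree since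
  \<open>h \<bullet> (axis k 1 \<times> b)\<close> is the \<open>k\<close>th component of
  \<open>b \<times> h\<close>, with \<open>h\<close> the first moment.\<close>

lemma spatial_inertia_quadratic_form:
  "v \<bullet> (spatial_inertia \<Phi> *v v) =
     (\<Sum>k\<in>UNIV. velocity_functional k v \<bullet> (pseudo_inertia \<Phi> *v velocity_functional k v))"
proof -
  define a b :: "real^3" where "a = (\<chi> i. v $ Inl i)" and "b = (\<chi> i. v $ Inr i)"
  have "velocity_functional k v \<bullet> (pseudo_inertia \<Phi> *v velocity_functional k v)
      = (trace (inertia \<Phi>) / 2 * (cross3 (axis k 1) b \<bullet> cross3 (axis k 1) b) -
         cross3 (axis k 1) b \<bullet> (inertia \<Phi> *v cross3 (axis k 1) b)) +
        (2 * a $ k * (first_moment \<Phi> \<bullet> cross3 (axis k 1) b) + mass \<Phi> * (a $ k)\<^sup>2)" for k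
    by (simp add: pseudo_inertia_inner velocity_functional_def a_def b_def)
  moreover have "(\<Sum>k\<in>UNIV. 2 * a $ k * (first_moment \<Phi> \<bullet> cross3 (axis k 1) b) + mass \<Phi> * (a $ k)\<^sup>2)
      = mass \<Phi> * (a \<bullet> a) - 2 * (a \<bullet> cross3 (first_moment \<Phi>) b)"
    by (simp add: inner_vec_def sum_3 cross3_def axis_def power2_eq_square algebra_simps)
  ultimately show ?thesis
    unfolding spatial_inertia_inner a_def[symmetric] b_def[symmetric] inertia_quadratic_form[of b]
    by (simp add: sum.distrib)
qed

section \<open>The unit reference body and monotonicity in the pseudo-inertia\<close>

text \<open>The moments of inertia are 2 so that the upper left block of the pseudo-inertia matrix
  is \<open>6 / 2 - 2 = 1\<close> times the identity.\<close>

definition unit_inertia :: "real^10" where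
  "unit_inertia = (\<chi> i. if i = 1 then 1 else if i \<in> {5, 6, 7} then 2 else 0)"

lemma mass_unit_inertia: "mass unit_inertia = 1"
  by (simp add: mass_def unit_inertia_def)

lemma first_moment_unit_inertia: "first_moment unit_inertia = 0"
  by (simp add: first_moment_def unit_inertia_def vec_eq_iff forall_3)

lemma inertia_unit_inertia: "inertia unit_inertia = mat 2"
  by (simp add: inertia_def unit_inertia_def vec_eq_iff forall_3 mat_def)

lemma pseudo_inertia_unit: "pseudo_inertia unit_inertia = mat 1"
  unfolding pseudo_inertia_def mass_unit_inertia first_moment_unit_inertia inertia_unit_inertia
  by (auto simp: block_matrix_def mat_def vec_eq_iff trace_def rowvector_def columnvector_def
      split: sum.split)

text \<open>The inequality is summed over the vectors \<open>velocity_functional k v\<close>, which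
  depend on neither parameter. With a factor on each side, one statement serves for lower bounds
  (\<open>d = 1\<close>) and upper bounds (\<open>c = 1\<close>).\<close>

lemma spatial_inertia_mono:
  assumes "\<And>w. c * (w \<bullet> (pseudo_inertia \<Phi> *v w)) \<le> d * (w \<bullet> (pseudo_inertia \<Psi> *v w))"
  shows "c * (v \<bullet> (spatial_inertia \<Phi> *v v)) \<le> d * (v \<bullet> (spatial_inertia \<Psi> *v v))"
  unfolding spatial_inertia_quadratic_form sum_distrib_left by (intro sum_mono assms)

lemma chain_inertia_mono:
  assumes "\<And>l w. c * (w \<bullet> (pseudo_inertia (\<Theta>1 $ l) *v w)) \<le> d * (w \<bullet> (pseudo_inertia (\<Theta>2 $ l) *v w))"
  shows "c * (v \<bullet> (chain_inertia \<Theta>1 *v v)) \<le> d * (v \<bullet> (chain_inertia \<Theta>2 *v v))"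
  unfolding chain_inertia_def inner_block_diag sum_distrib_left
  by (intro sum_mono spatial_inertia_mono assms)

lemma spatial_inertia_unit_ge: "v \<bullet> v \<le> v \<bullet> (spatial_inertia unit_inertia *v v)"
proof -
  define a b :: "real^3" where "a = (\<chi> i. v $ Inl i)" and "b = (\<chi> i. v $ Inr i)"
  have "v \<bullet> v = a \<bullet> a + b \<bullet> b"
    by (simp add: inner_vec_def sum_UNIV_Plus a_def b_def)
  also have "\<dots> \<le> a \<bullet> a + 2 * (b \<bullet> b)"
    by simp
  also have "\<dots> = v \<bullet> (spatial_inertia unit_inertia *v v)"
    by (simp add: spatial_inertia_inner mass_unit_inertia first_moment_unit_inertia
        inertia_unit_inertia mat_mult a_def b_def)
  finally show ?thesis .
qed

lemma chain_inertia_unit_ge: "v \<bullet> v \<le> v \<bullet> (chain_inertia (\<chi> l. unit_inertia) *v v)"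
proof -
  have "v \<bullet> v = (\<Sum>l\<in>UNIV. block v l \<bullet> block v l)"
    by (simp add: inner_vec_def sum_UNIV_prod block_def)
  then show ?thesis
    by (simp add: chain_inertia_def inner_block_diag sum_mono spatial_inertia_unit_ge)
qed

lemma physically_consistent_unit: "physically_consistent (\<chi> l. unit_inertia)"
  by (simp add: physically_consistent_def pos_def_def pseudo_inertia_unit symmetric_mat)

section \<open>Transfer to the mass matrix\<close>

lemma mass_matrix_congruence:
  "mass_matrix F R E q \<Theta> = transpose (chain_Q F R E q ** kin_jacobian F q) **
     chain_inertia \<Theta> ** (chain_Q F R E q ** kin_jacobian F q)"
  by (simp add: mass_matrix_def matrix_transpose_mul matrix_mul_assoc)

lemma symmetric_mass_matrix: "symmetric_matrix (mass_matrix F R E q \<Theta>)"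
  unfolding mass_matrix_congruence by (intro symmetric_congruence symmetric_chain_inertia)

lemma mass_matrix_mono:
  assumes "\<And>l w. c * (w \<bullet> (pseudo_inertia (\<Theta>1 $ l) *v w)) \<le> d * (w \<bullet> (pseudo_inertia (\<Theta>2 $ l) *v w))"
  shows "c * (x \<bullet> (mass_matrix F R E q \<Theta>1 *v x)) \<le> d * (x \<bullet> (mass_matrix F R E q \<Theta>2 *v x))"
  unfolding mass_matrix_congruence inner_congruence by (intro chain_inertia_mono assms)

section \<open>Loewner bounds, and real bounds from extended-real infima and suprema\<close>

lemma symmetric_scaled_identity: "symmetric_matrix (c *\<^sub>R mat 1)"
  by (auto simp: symmetric_matrix_def transpose_def mat_def vec_eq_iff)

lemma loewner_leI:
  fixes A B :: "real^'n^'n"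
  assumes "symmetric_matrix A" and "symmetric_matrix B"
    and "\<And>v. v \<bullet> (A *v v) \<le> v \<bullet> (B *v v)"
  shows "A \<preceq>\<^sub>L B"
  using assms
  by (auto simp: loewner_le_def pos_semidef_def symmetric_matrix_def transpose_def vec_eq_iff
      matrix_vector_mult_diff_rdistrib inner_diff_right)

lemma INF_ereal_pos_bound:
  assumes "(INF x\<in>X. ereal (f x)) > 0"
  obtains c where "c > 0" and "\<And>x. x \<in> X \<Longrightarrow> c \<le> f x"
proof -
  \<comment> \<open>A value strictly between is finite even when the infimum is infinite, as it is
    for empty \<open>X\<close>.\<close>
  obtain z where z: "0 < z" "z < (INF x\<in>X. ereal (f x))"
    using assms dense by blast
  then obtain c where c: "z = ereal c"
    by (cases z) auto
  show ?thesis
  proof (rule that[of c])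
    show "c > 0" using z c by simp
    show "c \<le> f x" if "x \<in> X" for x
      using z(2) c INF_lower[OF that, of "\<lambda>x. ereal (f x)"] by (metis ereal_less_eq(3) less_imp_le order_trans)
  qed
qed

lemma SUP_ereal_finite_bound:
  assumes "(SUP x\<in>X. ereal (f x)) < \<infinity>"
  obtains c where "\<And>x. x \<in> X \<Longrightarrow> f x \<le> c"
proof -
  obtain n :: nat where "(SUP x\<in>X. ereal (f x)) < ereal (real n)"
    using assms less_PInf_Ex_of_nat by auto
  then have "f x \<le> real n" if "x \<in> X" for x
    using SUP_upper[OF that, of "\<lambda>x. ereal (f x)"] by (metis ereal_less_eq(3) less_imp_le order_trans)
  then show ?thesis using that by blast
qed

theorem corollary1:
  fixes F :: "real^'n \<Rightarrow> real^('b::finite \<times> (3 + 3))"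
    and R E :: "real^3 \<Rightarrow> real^3^3"
    and \<Theta> :: "real \<Rightarrow> real^10^'b"
  assumes "\<And>q. F differentiable (at q)"
    and "\<And>\<phi>. rotation_matrix (R \<phi>)"
    and "angular_rate_matrix R E"
    and "normal_QJ F R E"
    and "\<And>\<Theta>0. physically_consistent \<Theta>0 \<Longrightarrow>
           (SUP q. ereal (lambda_max (mass_matrix F R E q \<Theta>0))) < \<infinity>"
    and "inertial_upper_bounded \<Theta>"
    and "uniformly_physically_consistent \<Theta>"
  shows "\<exists>\<alpha>1 \<alpha>2 :: real. 0 < \<alpha>1 \<and> \<alpha>1 \<le> \<alpha>2 \<and>
           (\<forall>q. \<forall>t\<ge>0. \<alpha>1 *\<^sub>R mat 1 \<preceq>\<^sub>L mass_matrix F R E q (\<Theta> t) \<and>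
                      mass_matrix F R E q (\<Theta> t) \<preceq>\<^sub>L \<alpha>2 *\<^sub>R mat 1)"
proof -
  define M where "M q = mass_matrix F R E q" for q
  define \<Theta>1 :: "real^10^'b" where "\<Theta>1 = (\<chi> l. unit_inertia)"

  have "\<exists>c>0. \<forall>t\<in>{0..}. c \<le> lambda_min (pseudo_inertia (\<Theta> t $ l))" for l
    using assms(7) INF_ereal_pos_bound unfolding uniformly_physically_consistent_def by metis
  then obtain a where a: "\<And>l. a l > 0"
    and a_le: "\<And>l t. t \<ge> 0 \<Longrightarrow> a l \<le> lambda_min (pseudo_inertia (\<Theta> t $ l))"
    by (metis atLeast_iff)
  \<comment> \<open>There are finitely many bodies, so the bounds for the single bodies have a
    positive minimum.\<close>
  define a0 where "a0 = Min (range a)"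
  have a0: "a0 > 0" and a0_le: "a0 \<le> a l" for l
    using a by (auto simp: a0_def)
  have lower: "a0 * (x \<bullet> (M q \<Theta>1 *v x)) \<le> x \<bullet> (M q (\<Theta> t) *v x)" if "t \<ge> 0" for q t x
  proof -
    have "a0 * (w \<bullet> w) \<le> w \<bullet> (pseudo_inertia (\<Theta> t $ l) *v w)" for l w
      using lambda_min_le_quadratic_form[OF symmetric_pseudo_inertia, where v = w and \<Phi>1 = "\<Theta> t $ l"]
        mult_right_mono[OF order_trans[OF a0_le a_le[OF that]], where c = "w \<bullet> w"]
      by (meson inner_ge_zero order_trans)
    \<comment> \<open>The pseudo-inertia matrices of \<open>\<Theta>1\<close> are the identity, so
      \<open>w \<bullet> w\<close> is their form at \<open>w\<close>.\<close>
    then have "a0 * (x \<bullet> (M q \<Theta>1 *v x)) \<le> 1 * (x \<bullet> (M q (\<Theta> t) *v x))"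
      unfolding M_def by (intro mass_matrix_mono) (simp add: \<Theta>1_def pseudo_inertia_unit)
    then show ?thesis by simp
  qed

  have "\<exists>c. \<forall>t\<in>{0..}. lambda_max (pseudo_inertia (\<Theta> t $ l)) \<le> c" for l
    using assms(6) SUP_ereal_finite_bound unfolding inertial_upper_bounded_def by metis
  then obtain b where b_ge: "\<And>l t. t \<ge> 0 \<Longrightarrow> lambda_max (pseudo_inertia (\<Theta> t $ l)) \<le> b l"
    by (metis atLeast_iff)
  \<comment> \<open>The maximum with 0 provides the sign needed to multiply \<open>unit_le\<close>
    by \<open>b0\<close> below.\<close>
  define b0 where "b0 = max 0 (Max (range b))"
  have b0: "b0 \<ge> 0" and b0_ge: "b l \<le> b0" for l
    by (auto simp: b0_def le_max_iff_disj)
  have upper: "x \<bullet> (M q (\<Theta> t) *v x) \<le> b0 * (x \<bullet> (M q \<Theta>1 *v x))" if "t \<ge> 0" for q t x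
  proof -
    have "w \<bullet> (pseudo_inertia (\<Theta> t $ l) *v w) \<le> b0 * (w \<bullet> w)" for l w
      using quadratic_form_le_lambda_max[OF symmetric_pseudo_inertia, where v = w and \<Phi>1 = "\<Theta> t $ l"]
        mult_right_mono[OF order_trans[OF b_ge[OF that] b0_ge], where c = "w \<bullet> w"]
      by (meson inner_ge_zero order_trans)
    then have "1 * (x \<bullet> (M q (\<Theta> t) *v x)) \<le> b0 * (x \<bullet> (M q \<Theta>1 *v x))"
      unfolding M_def by (intro mass_matrix_mono) (simp add: \<Theta>1_def pseudo_inertia_unit)
    then show ?thesis by simp
  qed

  define K where "K q = chain_Q F R E q ** kin_jacobian F q" for q
  \<comment> \<open>This is the matrix of the normality condition; the inserted identity gives it
    the shape of a congruence.\<close>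
  define G where "G q = transpose (K q) ** mat 1 ** K q" for q
  have "(INF q. ereal (lambda_min (G q))) > 0"
    using assms(4) by (simp add: normal_QJ_def G_def K_def matrix_transpose_mul matrix_mul_assoc)
  then obtain n where n: "n > 0" "\<And>q. n \<le> lambda_min (G q)"
    using INF_ereal_pos_bound by (metis UNIV_I)
  have unit_ge: "n * (x \<bullet> x) \<le> x \<bullet> (M q \<Theta>1 *v x)" for q x
  proof -
    have "n * (x \<bullet> x) \<le> lambda_min (G q) * (x \<bullet> x)"
      by (intro mult_right_mono n) simp
    also have "\<dots> \<le> x \<bullet> (G q *v x)"
      unfolding G_def by (intro lambda_min_le_quadratic_form symmetric_congruence symmetric_mat)
    also have "\<dots> = (K q *v x) \<bullet> (K q *v x)"
      unfolding G_def inner_congruence by simp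
    also have "\<dots> \<le> x \<bullet> (M q \<Theta>1 *v x)"
      unfolding M_def mass_matrix_congruence inner_congruence K_def \<Theta>1_def
      by (rule chain_inertia_unit_ge)
    finally show ?thesis .
  qed

  obtain m where m: "\<And>q. lambda_max (M q \<Theta>1) \<le> m"
    using SUP_ereal_finite_bound[OF assms(5)[OF physically_consistent_unit]]
    unfolding M_def \<Theta>1_def by (metis UNIV_I)
  have unit_le: "x \<bullet> (M q \<Theta>1 *v x) \<le> m * (x \<bullet> x)" for q x
    using quadratic_form_le_lambda_max[of "M q \<Theta>1" x] mult_right_mono[OF m[of q], of "x \<bullet> x"]
    by (simp add: M_def symmetric_mass_matrix)

  \<comment> \<open>Chaining \<open>lower\<close> with \<open>unit_ge\<close> gives
    \<open>a0 * n\<close>, and \<open>upper\<close> with \<open>unit_le\<close> gives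
    \<open>b0 * m\<close>. The maximum makes \<open>\<alpha>1 \<le> \<alpha>2\<close>
    immediate.\<close>
  define \<alpha>1 \<alpha>2 where "\<alpha>1 = a0 * n" and "\<alpha>2 = max (a0 * n) (b0 * m)"
  have "\<alpha>1 *\<^sub>R mat 1 \<preceq>\<^sub>L M q (\<Theta> t)" if "t \<ge> 0" for q t
  proof (rule loewner_leI)
    fix x
    show "x \<bullet> ((\<alpha>1 *\<^sub>R mat 1) *v x) \<le> x \<bullet> (M q (\<Theta> t) *v x)"
      using order_trans[OF mult_left_mono[OF unit_ge less_imp_le[OF a0]] lower[OF that]]
      by (simp add: scaled_identity_mult \<alpha>1_def mult.assoc)
  qed (simp_all add: M_def symmetric_mass_matrix symmetric_scaled_identity)
  moreover have "M q (\<Theta> t) \<preceq>\<^sub>L \<alpha>2 *\<^sub>R mat 1" if "t \<ge> 0" for q t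
  proof (rule loewner_leI)
    fix x
    have "x \<bullet> (M q (\<Theta> t) *v x) \<le> b0 * m * (x \<bullet> x)"
      using order_trans[OF upper[OF that] mult_left_mono[OF unit_le b0]] by (simp add: mult.assoc)
    also have "\<dots> \<le> \<alpha>2 * (x \<bullet> x)"
      by (intro mult_right_mono) (simp_all add: \<alpha>2_def)
    finally show "x \<bullet> (M q (\<Theta> t) *v x) \<le> x \<bullet> ((\<alpha>2 *\<^sub>R mat 1) *v x)"
      by (simp add: scaled_identity_mult)
  qed (simp_all add: M_def symmetric_mass_matrix symmetric_scaled_identity)
  moreover have "0 < \<alpha>1" "\<alpha>1 \<le> \<alpha>2"
    using a0 n by (simp_all add: \<alpha>1_def \<alpha>2_def)
  ultimately show ?thesis
    unfolding M_def by blast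
qed

end
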